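(* Let $K>2$ be an integer and consider the $K$-armed binary utility-based dueling bandit game, with action set $\boldsymbol{N}=\{(i,j): 1\le i\le j\le K\}$, outcome set $\boldsymbol{M}=\{0,1\}^K$, gain function $\mathcal{G}((i,j),\boldsymbol{m})=\frac{\boldsymbol{m}_i+\boldsymbol{m}_j}{2}$, and feedback function $\mathcal{H}((i,j),\boldsymbol{m})$ equal to "loss" if $\boldsymbol{m}_i<\boldsymbol{m}_j$, "tie" if $\boldsymbol{m}_i=\boldsymbol{m}_j$, and "win" if $\boldsymbol{m}_i>\boldsymbol{m}_j$. Then every pair of actions is locally observable: for all $a,b\in\boldsymbol{N}$, $\boldsymbol{g}_a-\boldsymbol{g}_b\in\operatorname{Im}\mathcal{S}_{a,b}^{\top}$, where $\boldsymbol{g}_a$ denotes the gain vector of the action $a$ and $\mathcal{S}_{a,b}$ the local signal matrix of the pair $(a,b)$.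
   Context: Gain vectors. For an action $a\in\boldsymbol{N}$, the gain vector is $\boldsymbol{g}_a=(\mathcal{G}(a,\boldsymbol{m}))_{\boldsymbol{m}\in\boldsymbol{M}}\in\mathbb{R}^{\boldsymbol{M}}$. Cells. Let $\Delta_{|\boldsymbol{M}|}=\{\boldsymbol{q}\in[0,1]^{\boldsymbol{M}} : \sum_{\boldsymbol{m}}\boldsymbol{q}_{\boldsymbol{m}}=1\}$. The cell of an action $a$ is the set of opponent strategies for which $a$ is optimal: $C_a=\{\boldsymbol{q}\in\Delta_{|\boldsymbol{M}|} : \boldsymbol{g}_a^{\top}\boldsymbol{q}=\max_{b\in\boldsymbol{N}}\boldsymbol{g}_b^{\top}\boldsymbol{q}\}$. Signal matrices. For an action $a$, let $\sigma_1,\dots,\sigma_{s_a}$ be the distinct symbols occurring among $\mathcal{H}(a,\boldsymbol{m})$, $\boldsymbol{m}\in\boldsymbol{M}$. The signal matrix $\mathcal{S}_a$ is the $s_a\times|\boldsymbol{M}|$ matrix with entries $\mathcal{S}_a(k,\boldsymbol{m})=1$ if $\mathcal{H}(a,\boldsymbol{m})=\sigma_k$ and $0$ otherwise. Local observability. For actions $a,b$, the local signal matrix $\mathcal{S}_{a,b}$ is obtained by stacking vertically the signal matrices $\mathcal{S}_c$ of all actions $c$ in the neighborhood action set $\{c\in\boldsymbol{N} : C_a\cap C_b\subseteq C_c\}$. The pair $(a,b)$ (equivalently, the difference $\boldsymbol{g}_a-\boldsymbol{g}_b$) is locally observable if $\boldsymbol{g}_a-\boldsymbol{g}_b\in\operatorname{Im}\mathcal{S}_{a,b}^{\top}$,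 i.e. it lies in the row space of $\mathcal{S}_{a,b}$. *)

theory Defs
  imports "Jordan_Normal_Form.VS_Connect"
begin

text \<open>
  A finite partial monitoring game. The lists of actions and outcomes enumerate finite sets
  (no repetitions are intended); their order only fixes the coordinates of vectors over the
  outcomes, and the order in which signal matrices are stacked.
\<close>

record ('a, 'm, 's) game =
  actions :: "'a list"
  outcomes :: "'m list"
  gain :: "'a \<Rightarrow> 'm \<Rightarrow> real"
  feedback :: "'a \<Rightarrow> 'm \<Rightarrow> 's"

definition gain_vector :: "('a, 'm, 's) game \<Rightarrow> 'a \<Rightarrow> real vec" where
  "gain_vector G a = vec (length (outcomes G)) (\<lambda>l. gain G a (outcomes G ! l))"

definition outcome_simplex :: "('a, 'm, 's) game \<Rightarrow> real vec set" where
  "outcome_simplex G =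
     {q \<in> carrier_vec (length (outcomes G)).
        (\<forall>l < length (outcomes G). 0 \<le> q $ l \<and> q $ l \<le> 1) \<and>
        (\<Sum>l < length (outcomes G). q $ l) = 1}"

definition cell :: "('a, 'm, 's) game \<Rightarrow> 'a \<Rightarrow> real vec set" where
  "cell G a =
     {q \<in> outcome_simplex G.
        gain_vector G a \<bullet> q = Max ((\<lambda>b. gain_vector G b \<bullet> q) ` set (actions G))}"

definition symbols :: "('a, 'm, 's) game \<Rightarrow> 'a \<Rightarrow> 's list" where
  "symbols G a = remdups (map (feedback G a) (outcomes G))"

definition signal_matrix :: "('a, 'm, 's) game \<Rightarrow> 'a \<Rightarrow> real mat" where
  "signal_matrix G a =
     mat (length (symbols G a)) (length (outcomes G))
       (\<lambda>(k, l). if feedback G a (outcomes G ! l) = symbols G a ! k then 1 else 0)"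

definition neighborhood :: "('a, 'm, 's) game \<Rightarrow> 'a \<Rightarrow> 'a \<Rightarrow> 'a list" where
  "neighborhood G a b = filter (\<lambda>c. cell G a \<inter> cell G b \<subseteq> cell G c) (actions G)"

definition local_signal_matrix :: "('a, 'm, 's) game \<Rightarrow> 'a \<Rightarrow> 'a \<Rightarrow> real mat" where
  "local_signal_matrix G a b =
     foldr (@\<^sub>r) (map (signal_matrix G) (neighborhood G a b)) (0\<^sub>m 0 (length (outcomes G)))"

definition mat_image :: "'r :: semiring_0 mat \<Rightarrow> 'r vec set" where
  "mat_image A = (\<lambda>y. A *\<^sub>v y) ` carrier_vec (dim_col A)"

definition locally_observable :: "('a, 'm, 's) game \<Rightarrow> 'a \<Rightarrow> 'a \<Rightarrow> bool" where
  "locally_observable G a b \<longleftrightarrow>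
     gain_vector G a - gain_vector G b \<in> mat_image (local_signal_matrix G a b)\<^sup>T"

datatype duel_symbol = Loss | Tie | Win

text \<open>
  Outcomes in \<open>{0,1}\<^sup>K\<close> are lists of length \<open>K\<close>. Arms are numbered from \<open>1\<close>, list positions
  from \<open>0\<close>.
\<close>

definition reward :: "nat list \<Rightarrow> nat \<Rightarrow> nat" where
  "reward m i = m ! (i - 1)"

definition dueling_bandit :: "nat \<Rightarrow> (nat \<times> nat, nat list, duel_symbol) game" where
  "dueling_bandit K =
     \<lparr> actions = [(i, j). i \<leftarrow> [1..<Suc K], j \<leftarrow> [i..<Suc K]],
       outcomes = List.n_lists K [0, 1],
       gain = (\<lambda>(i, j) m. (real (reward m i) + real (reward m j)) / 2),
       feedback = (\<lambda>(i, j) m.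
         if reward m i < reward m j then Loss
         else if reward m i = reward m j then Tie
         else Win) \<rparr>"

lemma set_actions_dueling_bandit:
  "set (actions (dueling_bandit K)) = {(i, j). 1 \<le> i \<and> i \<le> j \<and> j \<le> K}"
  by (force simp: dueling_bandit_def simp del: upt_Suc)

lemma set_outcomes_dueling_bandit:
  "set (outcomes (dueling_bandit K)) = {m. length m = K \<and> set m \<subseteq> {0, 1}}"
  by (simp add: dueling_bandit_def set_n_lists)

lemma distinct_actions_dueling_bandit: "distinct (actions (dueling_bandit K))"
proof -
  have "distinct (concat (map (\<lambda>i. map (Pair i) [i..<Suc K]) is))" if "distinct is" for "is"
    using that by (induction "is") (auto simp: distinct_map inj_on_def)
  from this[of "[1..<Suc K]"] show ?thesis by (simp add: dueling_bandit_def)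
qed

lemma distinct_outcomes_dueling_bandit: "distinct (outcomes (dueling_bandit K))"
  by (simp add: dueling_bandit_def distinct_n_lists)

lemma local_signal_matrix_carrier:
  "local_signal_matrix G a b \<in>
     carrier_mat (\<Sum>c\<leftarrow>neighborhood G a b. length (symbols G c)) (length (outcomes G))"
proof -
  have "foldr (@\<^sub>r) (map (signal_matrix G) cs) (0\<^sub>m 0 (length (outcomes G))) \<in>
     carrier_mat (\<Sum>c\<leftarrow>cs. length (symbols G c)) (length (outcomes G))" for cs
    by (induction cs) (auto simp: signal_matrix_def intro!: carrier_append_rows)
  then show ?thesis by (simp add: local_signal_matrix_def)
qed

lemma mat_image_transpose_eq_row_space:
  fixes A :: "real mat"
  assumes "A \<in> carrier_mat r n"
  shows "mat_image A\<^sup>T = vec_space.row_space n A"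
  using vec_space.row_space_eq[OF assms] assms by (auto simp: mat_image_def)

end

theory Submission
  imports Defs
begin

text \<open>
  An action is optimal against an opponent strategy iff both of its arms have maximal expected
  reward. Hence every duel between arms taken from \<open>a\<close> and \<open>b\<close> lies in the neighborhood of
  \<open>(a, b)\<close>. The feedback of the duel between \<open>k\<close> and \<open>l\<close> reveals the difference
  \<open>m\<^sub>k - m\<^sub>l\<close>, and the gain difference of \<open>(i, j)\<close> and \<open>(i', j')\<close> is the sum of
  \<open>(m\<^sub>i - m\<^sub>i\<^sub>') / 2\<close> and \<open>(m\<^sub>j - m\<^sub>j\<^sub>') / 2\<close>.
\<close>

lemma set_rows_append_rows:
  assumes "A \<in> carrier_mat r1 n" "B \<in> carrier_mat r2 n"
  shows "set (rows (A @\<^sub>r B)) = set (rows A) \<union> set (rows B)"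
proof -
  have ivl: "{0..<r1 + r2} = {0..<r1} \<union> (+) r1 ` {0..<r2}"
    by (simp add: ivl_disj_un_two(3) image_add_atLeastLessThan add.commute)
  have A: "row (A @\<^sub>r B) i = row A i" if "i < r1" for i
    using assms that by (intro eq_vecI) (auto simp: append_rows_def)
  have B: "row (A @\<^sub>r B) (r1 + i) = row B i" if "i < r2" for i
    using assms that by (intro eq_vecI) (auto simp: append_rows_def)
  have "set (rows (A @\<^sub>r B)) = row (A @\<^sub>r B) ` {0..<r1 + r2}"
    using carrier_matD(1)[OF carrier_append_rows[OF assms]] by (simp add: rows_def)
  also have "\<dots> = row (A @\<^sub>r B) ` {0..<r1} \<union> (\<lambda>i. row (A @\<^sub>r B) (r1 + i)) ` {0..<r2}"
    by (simp only: ivl image_Un image_image)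
  also have "\<dots> = row A ` {0..<r1} \<union> row B ` {0..<r2}"
    using A B by simp
  finally show ?thesis using assms by (simp add: rows_def)
qed

text \<open>The image of a transpose is the span of the rows, so only the set of rows of the stacked
  matrix matters; the order and repetition of rows do not.\<close>

lemma set_rows_local_signal_matrix:
  "set (rows (local_signal_matrix G a b)) =
     (\<Union>c \<in> set (neighborhood G a b). set (rows (signal_matrix G c)))"
proof -
  let ?n = "length (outcomes G)"
  \<comment> \<open>The column count is carried through the induction because
    \<open>set_rows_append_rows\<close> needs it of the matrix stacked so far.\<close>
  have "(\<exists>r. foldr (@\<^sub>r) (map (signal_matrix G) cs) (0\<^sub>m 0 ?n) \<in> carrier_mat r ?n) \<and>
    set (rows (foldr (@\<^sub>r) (map (signal_matrix G) cs) (0\<^sub>m 0 ?n))) =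
      (\<Union>c \<in> set cs. set (rows (signal_matrix G c)))" for cs
  proof (induction cs)
    case Nil
    show ?case by (auto simp: rows_def intro: zero_carrier_mat)
  next
    case (Cons c cs)
    have S: "signal_matrix G c \<in> carrier_mat (length (symbols G c)) ?n"
      by (simp add: signal_matrix_def)
    from Cons obtain r where
      R: "foldr (@\<^sub>r) (map (signal_matrix G) cs) (0\<^sub>m 0 ?n) \<in> carrier_mat r ?n" by blast
    show ?case
      using carrier_append_rows[OF S R] set_rows_append_rows[OF S R] Cons by auto
  qed
  then show ?thesis by (simp add: local_signal_matrix_def)
qed

text \<open>The rows of the signal matrix are the indicator vectors of the symbols. Weighting the
  row of each symbol \<open>s\<close> by \<open>f s\<close> produces any prescribed function
  \<open>f\<close> of the feedback.\<close>

lemma feedback_function_in_mat_image_signal_matrix: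
  "vec (length (outcomes G)) (\<lambda>l. f (feedback G c (outcomes G ! l))) \<in>
     mat_image (signal_matrix G c)\<^sup>T"
proof -
  let ?s = "symbols G c" and ?n = "length (outcomes G)"
  have "vec ?n (\<lambda>l. f (feedback G c (outcomes G ! l))) =
      (signal_matrix G c)\<^sup>T *\<^sub>v vec (length ?s) (\<lambda>k. f (?s ! k))"
  proof (intro eq_vecI)
    fix l assume "l < dim_vec ((signal_matrix G c)\<^sup>T *\<^sub>v vec (length ?s) (\<lambda>k. f (?s ! k)))"
    then have l: "l < ?n" by (simp add: signal_matrix_def)
    let ?x = "feedback G c (outcomes G ! l)"
    have "((signal_matrix G c)\<^sup>T *\<^sub>v vec (length ?s) (\<lambda>k. f (?s ! k))) $ l =
        (\<Sum>k = 0..<length ?s. (if ?x = ?s ! k then 1 else 0) * f (?s ! k))"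
      using l by (simp add: signal_matrix_def scalar_prod_def)
    also have "\<dots> = (\<Sum>s\<leftarrow>?s. (if ?x = s then 1 else 0) * f s)"
      by (simp add: sum_list_sum_nth)
    \<comment> \<open>\<open>remdups\<close> makes the symbols distinct, so each outcome meets
      exactly one nonzero term.\<close>
    also have "\<dots> = (\<Sum>s\<in>set ?s. (if ?x = s then 1 else 0) * f s)"
      by (simp add: symbols_def sum_list_distinct_conv_sum_set)
    also have "\<dots> = (\<Sum>s\<in>set ?s. if ?x = s then f s else 0)"
      by (intro sum.cong) auto
    also have "\<dots> = f ?x"
      using l by (auto simp: symbols_def)
    finally show "vec ?n (\<lambda>l. f (feedback G c (outcomes G ! l))) $ l =
        ((signal_matrix G c)\<^sup>T *\<^sub>v vec (length ?s) (\<lambda>k. f (?s ! k))) $ l"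
      using l by simp
  qed (simp add: signal_matrix_def)
  then show ?thesis by (auto simp: mat_image_def signal_matrix_def)
qed

text \<open>The rows of a neighborhood action occur among the stacked rows, and spans are
  monotone.\<close>

lemma mat_image_signal_matrix_subset_local:
  assumes "c \<in> set (neighborhood G a b)"
  shows "mat_image (signal_matrix G c)\<^sup>T \<subseteq> mat_image (local_signal_matrix G a b)\<^sup>T"
proof -
  interpret vec_space "TYPE(real)" "length (outcomes G)" .
  have S: "signal_matrix G c \<in> carrier_mat (length (symbols G c)) (length (outcomes G))"
    by (simp add: signal_matrix_def)
  have "set (rows (signal_matrix G c)) \<subseteq> set (rows (local_signal_matrix G a b))"
    using assms by (auto simp: set_rows_local_signal_matrix)
  then show ?thesis
    unfolding mat_image_transpose_eq_row_space[OF S]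
      mat_image_transpose_eq_row_space[OF local_signal_matrix_carrier] row_space_def
    by (rule span_is_monotone)
qed

lemma mat_image_add:
  assumes "v \<in> mat_image A" "w \<in> mat_image A"
  shows "v + w \<in> mat_image A"
proof -
  obtain x y where "x \<in> carrier_vec (dim_col A)" "v = A *\<^sub>v x"
    "y \<in> carrier_vec (dim_col A)" "w = A *\<^sub>v y"
    using assms by (auto simp: mat_image_def)
  then have "v + w = A *\<^sub>v (x + y)" "x + y \<in> carrier_vec (dim_col A)"
    by (simp_all add: mult_add_distrib_mat_vec[of A "dim_row A" "dim_col A"])
  then show ?thesis by (auto simp: mat_image_def)
qed

text \<open>For \<open>q\<close> in the simplex this is the mean reward of arm \<open>k\<close>,
  that is, the probability that its reward is 1.\<close>

definition expected_reward :: "nat \<Rightarrow> real vec \<Rightarrow> nat \<Rightarrow> real" where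
  "expected_reward K q k =
     (\<Sum>l<length (outcomes (dueling_bandit K)).
        real (reward (outcomes (dueling_bandit K) ! l) k) * q $ l)"

lemma gain_dueling_bandit [simp]:
  "gain (dueling_bandit K) (i, j) m = (real (reward m i) + real (reward m j)) / 2"
  by (simp add: dueling_bandit_def)

lemma gain_vector_scalar_prod:
  assumes "q \<in> outcome_simplex (dueling_bandit K)"
  shows "gain_vector (dueling_bandit K) (i, j) \<bullet> q =
    (expected_reward K q i + expected_reward K q j) / 2"
proof -
  let ?O = "outcomes (dueling_bandit K)"
  have "gain_vector (dueling_bandit K) (i, j) \<bullet> q =
      (\<Sum>l<length ?O. (real (reward (?O ! l) i) * q $ l + real (reward (?O ! l) j) * q $ l) / 2)"
    using assms
    by (auto simp: gain_vector_def outcome_simplex_def scalar_prod_def atLeast0LessThan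
        distrib_right intro!: sum.cong)
  then show ?thesis
    by (simp only: expected_reward_def sum.distrib sum_divide_distrib[symmetric])
qed

lemma mem_cell_dueling_bandit:
  assumes "(i, j) \<in> set (actions (dueling_bandit K))"
  shows "q \<in> cell (dueling_bandit K) (i, j) \<longleftrightarrow>
    q \<in> outcome_simplex (dueling_bandit K) \<and>
    (\<forall>k \<in> {1..K}. expected_reward K q k \<le> expected_reward K q i) \<and>
    (\<forall>k \<in> {1..K}. expected_reward K q k \<le> expected_reward K q j)"
proof (cases "q \<in> outcome_simplex (dueling_bandit K)")
  case True
  let ?G = "dueling_bandit K" and ?p = "expected_reward K q"
  have ij: "i \<in> {1..K}" "j \<in> {1..K}"
    using assms by (auto simp: set_actions_dueling_bandit)
  have le: "gain_vector ?G (k, l) \<bullet> q \<le> gain_vector ?G (i, j) \<bullet> q \<longleftrightarrow>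
      ?p k + ?p l \<le> ?p i + ?p j" for k l
    unfolding gain_vector_scalar_prod[OF True] divide_le_cancel by simp
  \<comment> \<open>The maximum ranges over a finite set that contains the value of
    \<open>(i, j)\<close> itself, so equality reduces to being an upper bound.\<close>
  have "gain_vector ?G (i, j) \<bullet> q = Max ((\<lambda>b. gain_vector ?G b \<bullet> q) ` set (actions ?G)) \<longleftrightarrow>
      (\<forall>b \<in> set (actions ?G). gain_vector ?G b \<bullet> q \<le> gain_vector ?G (i, j) \<bullet> q)"
    using assms by (subst eq_commute, subst Max_eq_iff) auto
  also have "\<dots> \<longleftrightarrow> (\<forall>k l. 1 \<le> k \<and> k \<le> l \<and> l \<le> K \<longrightarrow> ?p k + ?p l \<le> ?p i + ?p j)"
    by (auto simp: set_actions_dueling_bandit le)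
  also have "\<dots> \<longleftrightarrow> (\<forall>k \<in> {1..K}. ?p k \<le> ?p i) \<and> (\<forall>k \<in> {1..K}. ?p k \<le> ?p j)"
    (is "?L \<longleftrightarrow> ?R")
  proof
    assume ?L
    \<comment> \<open>Compare with the diagonal duel \<open>(k, k)\<close>. Taking
      \<open>k = i\<close> and \<open>k = j\<close> forces \<open>?p i = ?p j\<close>, so each of
      the two bounds every \<open>?p k\<close>.\<close>
    then have "?p k + ?p k \<le> ?p i + ?p j" if "k \<in> {1..K}" for k
      using that by (metis atLeastAtMost_iff order_refl)
    from this this[OF ij(1)] this[OF ij(2)] show ?R by fastforce
  next
    assume ?R
    then show ?L by (auto intro!: add_mono)
  qed
  finally show ?thesis using True by (simp add: cell_def)
qed (simp add: cell_def)

text \<open>On the intersection of the two cells all four arms attain the maximal expected reward,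
  so any duel among them is optimal there. The condition \<open>k \<le> l\<close> makes the pair an
  action.\<close>

lemma duel_in_neighborhood:
  assumes "(i, j) \<in> set (actions (dueling_bandit K))" "(i', j') \<in> set (actions (dueling_bandit K))"
    and "k \<in> {i, j, i', j'}" "l \<in> {i, j, i', j'}" "k \<le> l"
  shows "(k, l) \<in> set (neighborhood (dueling_bandit K) (i, j) (i', j'))"
proof -
  have "(k, l) \<in> set (actions (dueling_bandit K))"
    using assms by (auto simp: set_actions_dueling_bandit)
  with assms show ?thesis
    by (auto simp: neighborhood_def mem_cell_dueling_bandit)
qed

fun duel_outcome :: "duel_symbol \<Rightarrow> real" where
  "duel_outcome Loss = - 1"
| "duel_outcome Tie = 0"
| "duel_outcome Win = 1"

text \<open>The feedback tells the sign of the reward difference. For binary rewards the difference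
  is -1, 0 or 1 and hence equals its sign.\<close>

lemma duel_outcome_feedback:
  assumes "m \<in> set (outcomes (dueling_bandit K))" "k \<in> {1..K}" "l \<in> {1..K}"
  shows "duel_outcome (feedback (dueling_bandit K) (k, l) m) =
    real (reward m k) - real (reward m l)"
proof -
  \<comment> \<open>Arm \<open>k\<close> sits at list position \<open>k - 1\<close>, which is below
    \<open>K\<close> for \<open>k\<close> in \<open>{1..K}\<close>.\<close>
  have "reward m k \<in> set m" "reward m l \<in> set m"
    using assms by (auto simp: set_outcomes_dueling_bandit reward_def intro!: nth_mem)
  then have "reward m k \<in> {0, 1}" "reward m l \<in> {0, 1}"
    using assms(1) unfolding set_outcomes_dueling_bandit by blast+
  then show ?thesis by (auto simp: dueling_bandit_def)
qed

lemma reward_difference_in_mat_image: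
  fixes K :: nat
  defines "G \<equiv> dueling_bandit K"
  assumes a: "(i, j) \<in> set (actions G)" and b: "(i', j') \<in> set (actions G)"
    and k: "k \<in> {i, j, i', j'}" and l: "l \<in> {i, j, i', j'}"
  shows "vec (length (outcomes G))
      (\<lambda>t. (real (reward (outcomes G ! t) k) - real (reward (outcomes G ! t) l)) / 2) \<in>
    mat_image (local_signal_matrix G (i, j) (i', j'))\<^sup>T" (is "?v \<in> ?I")
proof -
  have kl: "k \<in> {1..K}" "l \<in> {1..K}"
    using a b k l by (auto simp: G_def set_actions_dueling_bandit)
  have *: "vec (length (outcomes G)) (\<lambda>t. f (feedback G c (outcomes G ! t))) \<in> ?I"
    if "c \<in> set (neighborhood G (i, j) (i', j'))" for c f
    by (rule subsetD[OF mat_image_signal_matrix_subset_local[OF that]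
          feedback_function_in_mat_image_signal_matrix])
  show ?thesis
  proof (cases "k \<le> l")
    case True
    have "?v = vec (length (outcomes G))
        (\<lambda>t. duel_outcome (feedback G (k, l) (outcomes G ! t)) / 2)"
      using kl by (auto simp: G_def duel_outcome_feedback)
    then show ?thesis
      using *[of "(k, l)" "\<lambda>s. duel_outcome s / 2"] duel_in_neighborhood True a b k l
      unfolding G_def by simp
  next
    case False
    \<comment> \<open>Here \<open>(k, l)\<close> is not an action; the duel \<open>(l, k)\<close> is
      observed instead and its sign reversed.\<close>
    have "?v = vec (length (outcomes G))
        (\<lambda>t. - duel_outcome (feedback G (l, k) (outcomes G ! t)) / 2)"
      using kl by (intro eq_vecI) (simp_all add: G_def duel_outcome_feedback diff_divide_distrib)
    then show ?thesis
      using *[of "(l, k)" "\<lambda>s. - duel_outcome s / 2"] duel_in_neighborhood False a b k l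
      unfolding G_def by simp
  qed
qed

theorem theorem2:
  fixes K :: nat
  assumes "K > 2"
  shows "\<forall>a \<in> set (actions (dueling_bandit K)). \<forall>b \<in> set (actions (dueling_bandit K)).
           locally_observable (dueling_bandit K) a b"
proof (intro ballI)
  let ?G = "dueling_bandit K"
  fix a b assume a: "a \<in> set (actions ?G)" and b: "b \<in> set (actions ?G)"
  obtain i j i' j' where ab: "a = (i, j)" "b = (i', j')" by fastforce
  let ?d = "\<lambda>k l. vec (length (outcomes ?G))
      (\<lambda>t. (real (reward (outcomes ?G ! t) k) - real (reward (outcomes ?G ! t) l)) / 2)"
  \<comment> \<open>First arms are paired with each other, and so are second arms. Neither pair need
    be ordered, which is why reward differences were obtained for both orders.\<close>
  have "gain_vector ?G a - gain_vector ?G b = ?d i i' + ?d j j'"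
    by (auto simp: ab gain_vector_def diff_divide_distrib add_divide_distrib)
  moreover have "?d i i' + ?d j j' \<in> mat_image (local_signal_matrix ?G a b)\<^sup>T"
    using a b unfolding ab
    by (intro mat_image_add reward_difference_in_mat_image) auto
  ultimately show "locally_observable ?G a b"
    by (simp add: locally_observable_def)
qed

end
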